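(* Let $k$ be an algebraically closed field of arbitrary characteristic. Let $d\geq 2$ be an integer and let $r=s^d$ be the $d$-th power of a positive integer $s$. For integers $\delta\ge 0$ and $\mu\geq 1$, if $\delta<\sqrt[d]{r}\,\mu$, then $l(d,\delta,\mu^r)=0$; that is, for general points $p_1,\dots,p_r\in\mathbb{P}^d_k$, the only homogeneous polynomial of degree $\delta$ in $k[X_0,\dots,X_d]$ vanishing with order at least $\mu$ at each of $p_1,\dots,p_r$ is $0$.
   Context: For integers $d,\delta,\mu,r$, $l(d,\delta,\mu^r)$ denotes the dimension over $k$ of the vector space of homogeneous polynomials of degree $\delta$ in $k[X_0,\dots,X_d]$ that vanish with order at least $\mu$ at each of $r$ general points $p_1,\dots,p_r$ of $\mathbb{P}^d_k$. Here "general" means that $(p_1,\dots,p_r)$ lies in a suitable nonempty Zariski open subset (which may depend on $d,\delta,\mu,r$) of $(\mathbb{P}^d_k)^r$, on which this dimension takes its minimal (generic) value. Vanishing with order at least $\mu$ at a point $p$ means that a local equation of the polynomial at $p$ lies in the $\mu$-th power of the maximal ideal of the local ring at $p$. *)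

theory Defs
  imports
    Complex_Main
    "HOL-Library.Poly_Mapping"
    "HOL-Library.FuncSet"
    "HOL-Computational_Algebra.Computational_Algebra"
begin

text \<open>
  A monomial in variables of type \<open>'v\<close> is a finitely supported exponent vector, and a
  polynomial is a finitely supported function from monomials to coefficients; the product of
  \<open>Poly_Mapping\<close> (convolution) is then the product of polynomials.
\<close>

type_synonym ('v, 'k) mpoly = "('v \<Rightarrow>\<^sub>0 nat) \<Rightarrow>\<^sub>0 'k"

definition eval :: "('v \<Rightarrow> 'k::field) \<Rightarrow> ('v, 'k) mpoly \<Rightarrow> 'k" where
  "eval x F = (\<Sum>m\<in>Poly_Mapping.keys F. Poly_Mapping.lookup F m * (\<Prod>v\<in>Poly_Mapping.keys m. x v ^ Poly_Mapping.lookup m v))"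

definition Var :: "nat \<Rightarrow> (nat, 'k::field) mpoly" where
  "Var i = Poly_Mapping.single (Poly_Mapping.single i 1) 1"

definition scale :: "'k::field \<Rightarrow> (nat, 'k) mpoly \<Rightarrow> (nat, 'k) mpoly" where
  "scale c F = Poly_Mapping.single 0 c * F"

lemma vector_space_scale: "vector_space (scale :: 'k::field \<Rightarrow> _)"
proof unfold_locales
  fix a b :: 'k and x y :: "(nat, 'k) mpoly"
  show "scale a (x + y) = scale a x + scale a y"
    by (simp add: scale_def distrib_left)
  show "scale (a + b) x = scale a x + scale b x"
    by (simp add: scale_def single_add distrib_right)
  show "scale a (scale b x) = scale (a * b) x"
    by (simp add: scale_def mult_single flip: mult.assoc)
  show "scale 1 x = x"
    by (simp add: scale_def)
qed

text \<open>
  Membership in the degree \<open>n\<close> part of \<open>k[X\<^sub>0,\<dots>,X\<^sub>d]\<close>, which contains \<open>0\<close> for every \<open>n\<close>.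
\<close>

definition homogeneous :: "nat \<Rightarrow> nat \<Rightarrow> (nat, 'k::field) mpoly \<Rightarrow> bool" where
  "homogeneous d n F \<longleftrightarrow>
     (\<forall>m\<in>Poly_Mapping.keys F. Poly_Mapping.keys m \<subseteq> {..d} \<and> (\<Sum>j\<in>Poly_Mapping.keys m. Poly_Mapping.lookup m j) = n)"

text \<open>
  A point of \<open>\<P>\<^sup>d\<close> is the set of all its homogeneous coordinate vectors; coordinates are indexed
  by \<open>0, \<dots>, d\<close>, and coordinate vectors are extended by \<open>0\<close> beyond \<open>d\<close>.
\<close>

definition coord_vectors :: "nat \<Rightarrow> (nat \<Rightarrow> 'k::field) set" where
  "coord_vectors d = {x. (\<forall>j>d. x j = 0) \<and> (\<exists>j\<le>d. x j \<noteq> 0)}"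

definition proj_rel :: "nat \<Rightarrow> ((nat \<Rightarrow> 'k::field) \<times> (nat \<Rightarrow> 'k)) set" where
  "proj_rel d = {(x, y). x \<in> coord_vectors d \<and> y \<in> coord_vectors d \<and>
                         (\<exists>c. c \<noteq> 0 \<and> y = (\<lambda>j. c * x j))}"

lemma equiv_proj_rel: "equiv (coord_vectors d :: (nat \<Rightarrow> 'k::field) set) (proj_rel d)"
proof (rule equivI)
  show "proj_rel d \<subseteq> coord_vectors d \<times> (coord_vectors d :: (nat \<Rightarrow> 'k) set)"
    by (auto simp: proj_rel_def)
  show "refl_on (coord_vectors d :: (nat \<Rightarrow> 'k) set) (proj_rel d)"
    by (auto simp: refl_on_def proj_rel_def intro!: exI[of _ 1])
  show "sym (proj_rel d :: ((nat \<Rightarrow> 'k) \<times> _) set)"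
  proof (rule symI)
    fix x y :: "nat \<Rightarrow> 'k"
    assume "(x, y) \<in> proj_rel d"
    then obtain c where c: "x \<in> coord_vectors d" "y \<in> coord_vectors d" "c \<noteq> 0" "y = (\<lambda>j. c * x j)"
      by (auto simp: proj_rel_def)
    then have "inverse c \<noteq> 0 \<and> x = (\<lambda>j. inverse c * y j)"
      by (simp flip: mult.assoc)
    with c(1,2) show "(y, x) \<in> proj_rel d"
      unfolding proj_rel_def by blast
  qed
  show "trans (proj_rel d :: ((nat \<Rightarrow> 'k) \<times> _) set)"
  proof (rule transI)
    fix x y z :: "nat \<Rightarrow> 'k"
    assume "(x, y) \<in> proj_rel d" "(y, z) \<in> proj_rel d"
    then obtain c e where ce: "x \<in> coord_vectors d" "z \<in> coord_vectors d"
      "c \<noteq> 0" "y = (\<lambda>j. c * x j)" "e \<noteq> 0" "z = (\<lambda>j. e * y j)"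
      by (auto simp: proj_rel_def)
    then have "e * c \<noteq> 0 \<and> z = (\<lambda>j. (e * c) * x j)"
      by (simp add: mult.assoc)
    with ce(1,2) show "(x, z) \<in> proj_rel d"
      unfolding proj_rel_def by blast
  qed
qed

definition proj_space :: "nat \<Rightarrow> (nat \<Rightarrow> 'k::field) set set" where
  "proj_space d = coord_vectors d // proj_rel d"

text \<open>
  The local ring of \<open>\<P>\<^sup>d\<close> at \<open>P\<close> and its maximal ideal, as subsets of the field of fractions of
  the polynomial ring: quotients of forms of equal degree whose denominator does not vanish at \<open>P\<close>.
\<close>

definition local_ring :: "nat \<Rightarrow> (nat \<Rightarrow> 'k::field) set \<Rightarrow> (nat, 'k) mpoly fract set" where
  "local_ring d P = {Fract G H | G H. \<exists>n. homogeneous d n G \<and> homogeneous d n H \<and>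
                                          (\<forall>x\<in>P. eval x H \<noteq> 0)}"

definition max_ideal :: "nat \<Rightarrow> (nat \<Rightarrow> 'k::field) set \<Rightarrow> (nat, 'k) mpoly fract set" where
  "max_ideal d P = {Fract G H | G H. \<exists>n. homogeneous d n G \<and> homogeneous d n H \<and>
                                         (\<forall>x\<in>P. eval x H \<noteq> 0) \<and> (\<forall>x\<in>P. eval x G = 0)}"

definition ideal_prod :: "'a::comm_ring_1 set \<Rightarrow> 'a set \<Rightarrow> 'a set" where
  "ideal_prod I J = {\<Sum>t<n. a t * b t | a b (n::nat). \<forall>t<n. a t \<in> I \<and> b t \<in> J}"

primrec max_ideal_power ::
  "nat \<Rightarrow> (nat \<Rightarrow> 'k::field) set \<Rightarrow> nat \<Rightarrow> (nat, 'k) mpoly fract set" where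
  "max_ideal_power d P 0 = local_ring d P"
| "max_ideal_power d P (Suc n) = ideal_prod (max_ideal d P) (max_ideal_power d P n)"

text \<open>
  On the chart \<open>X\<^sub>i \<noteq> 0\<close>, a form \<open>F\<close> of degree \<open>\<delta>\<close> has the local equation \<open>F / X\<^sub>i\<^sup>\<delta>\<close>; the local
  equations on different charts through \<open>P\<close> differ by a unit of the local ring.
\<close>

definition vanishes_to_order ::
  "nat \<Rightarrow> nat \<Rightarrow> nat \<Rightarrow> (nat \<Rightarrow> 'k::field) set \<Rightarrow> (nat, 'k) mpoly \<Rightarrow> bool" where
  "vanishes_to_order d \<delta> \<mu> P F \<longleftrightarrow>
     (\<forall>i\<le>d. (\<forall>x\<in>P. x i \<noteq> 0) \<longrightarrow> Fract F (Var i ^ \<delta>) \<in> max_ideal_power d P \<mu>)"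

definition fat_point_forms ::
  "nat \<Rightarrow> nat \<Rightarrow> nat \<Rightarrow> nat \<Rightarrow> (nat \<Rightarrow> (nat \<Rightarrow> 'k::field) set) \<Rightarrow> (nat, 'k) mpoly set" where
  "fat_point_forms d \<delta> \<mu> r p =
     {F. homogeneous d \<delta> F \<and> (\<forall>i<r. vanishes_to_order d \<delta> \<mu> (p i) F)}"

definition proj_tuples :: "nat \<Rightarrow> nat \<Rightarrow> (nat \<Rightarrow> (nat \<Rightarrow> 'k::field) set) set" where
  "proj_tuples d r = {..<r} \<rightarrow>\<^sub>E proj_space d"

text \<open>
  The Zariski topology on \<open>(\<P>\<^sup>d)\<^sup>r\<close>: closed sets are the common zero sets of families of
  multihomogeneous polynomials in \<open>r\<close> groups of \<open>d + 1\<close> variables; the variable \<open>(i, j)\<close> stands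
  for the \<open>j\<close>-th homogeneous coordinate of the \<open>i\<close>-th point.
\<close>

definition multihomogeneous :: "nat \<Rightarrow> nat \<Rightarrow> (nat \<times> nat, 'k::field) mpoly \<Rightarrow> bool" where
  "multihomogeneous d r G \<longleftrightarrow>
     (\<exists>e. \<forall>m\<in>Poly_Mapping.keys G. Poly_Mapping.keys m \<subseteq> {..<r} \<times> {..d} \<and> (\<forall>i<r. (\<Sum>j\<le>d. Poly_Mapping.lookup m (i, j)) = e i))"

definition zariski_closed ::
  "nat \<Rightarrow> nat \<Rightarrow> (nat \<Rightarrow> (nat \<Rightarrow> 'k::field) set) set \<Rightarrow> bool" where
  "zariski_closed d r Z \<longleftrightarrow>
     (\<exists>S. (\<forall>G\<in>S. multihomogeneous d r G) \<and>
          Z = {p \<in> proj_tuples d r. \<forall>G\<in>S. \<forall>x. (\<forall>i<r. x i \<in> p i) \<longrightarrow> eval (\<lambda>(i, j). x i j) G = 0})"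

definition zariski_open ::
  "nat \<Rightarrow> nat \<Rightarrow> (nat \<Rightarrow> (nat \<Rightarrow> 'k::field) set) set \<Rightarrow> bool" where
  "zariski_open d r U \<longleftrightarrow> U \<subseteq> proj_tuples d r \<and> zariski_closed d r (proj_tuples d r - U)"

definition for_general_points ::
  "nat \<Rightarrow> nat \<Rightarrow> ((nat \<Rightarrow> (nat \<Rightarrow> 'k::field) set) \<Rightarrow> bool) \<Rightarrow> bool" where
  "for_general_points d r Q \<longleftrightarrow> (\<exists>U. zariski_open d r U \<and> U \<noteq> {} \<and> (\<forall>p\<in>U. Q p))"

text \<open>
  \<open>l(d,\<delta>,\<mu>\<^sup>r)\<close> over the field \<open>'k\<close>: the value of the dimension at general points, which is also its
  minimum over all tuples of points. The minimality clause makes the value unique; it exists by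
  semicontinuity of the dimension.
\<close>

definition general_dim :: "'k::field itself \<Rightarrow> nat \<Rightarrow> nat \<Rightarrow> nat \<Rightarrow> nat \<Rightarrow> nat" where
  "general_dim TYPE('k) d \<delta> \<mu> r =
     (THE n. for_general_points d r
               (\<lambda>p :: nat \<Rightarrow> (nat \<Rightarrow> 'k) set. vector_space.dim scale (fat_point_forms d \<delta> \<mu> r p) = n) \<and>
             (\<forall>p \<in> proj_tuples d r :: (nat \<Rightarrow> (nat \<Rightarrow> 'k) set) set.
                n \<le> vector_space.dim scale (fat_point_forms d \<delta> \<mu> r p)))"

lemma general_dim_eqI:
  assumes "for_general_points d r
             (\<lambda>p :: nat \<Rightarrow> (nat \<Rightarrow> 'k::field) set. vector_space.dim scale (fat_point_forms d \<delta> \<mu> r p) = n)"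
    and "\<forall>p \<in> proj_tuples d r :: (nat \<Rightarrow> (nat \<Rightarrow> 'k) set) set.
           n \<le> vector_space.dim scale (fat_point_forms d \<delta> \<mu> r p)"
  shows "general_dim TYPE('k) d \<delta> \<mu> r = n"
  unfolding general_dim_def
proof (rule the_equality, intro conjI assms)
  fix n'
  assume *: "for_general_points d r
      (\<lambda>p :: nat \<Rightarrow> (nat \<Rightarrow> 'k) set. vector_space.dim scale (fat_point_forms d \<delta> \<mu> r p) = n') \<and>
    (\<forall>p \<in> proj_tuples d r :: (nat \<Rightarrow> (nat \<Rightarrow> 'k) set) set.
       n' \<le> vector_space.dim scale (fat_point_forms d \<delta> \<mu> r p))"
  obtain p p' :: "nat \<Rightarrow> (nat \<Rightarrow> 'k) set" where
    "p \<in> proj_tuples d r" "vector_space.dim scale (fat_point_forms d \<delta> \<mu> r p) = n"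
    "p' \<in> proj_tuples d r" "vector_space.dim scale (fat_point_forms d \<delta> \<mu> r p') = n'"
    using assms(1) * unfolding for_general_points_def zariski_open_def by blast
  with assms(2) * show "n' = n"
    by (metis le_antisym)
qed

end

theory Submission
  imports Defs
begin

text \<open>
  Having a nonzero form of degree \<open>\<delta>\<close> with multiplicity \<open>\<mu>\<close> at \<open>r\<close> given points is a closed
  condition on the points, so it suffices to exhibit one tuple of \<open>s\<^sup>d\<close> points for which there is
  no such form. The grid of all \<open>(1, a\<^sub>1, \<dots>, a\<^sub>d)\<close> with \<open>a\<^sub>j \<in> S\<close>, for a set \<open>S\<close> of \<open>s\<close> scalars,
  does this in every characteristic, by Bezout's argument with hyperplanes
  (\<open>form_zero_if_mult_on_grid\<close>). Among the \<open>s\<close> hyperplanes \<open>X\<^sub>d = c X\<^sub>0\<close> take one on which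
  the required multiplicity \<open>M c\<close> is largest. Since \<open>\<delta> < \<Sum>\<^sub>c M c \<le> s \<cdot> M c\<close>, the restriction of
  the form to this hyperplane satisfies the hypotheses in one dimension less, hence is zero, and the
  form is divisible by \<open>X\<^sub>d - c X\<^sub>0\<close>. The quotient has degree \<open>\<delta> - 1\<close> and loses only one multiplicity,
  at the points of that hyperplane, so the inequality persists and the degree descends to a
  contradiction.

  To make multiplicity computable without derivatives, which misbehave in positive characteristic,
  it is tested on lines: \<open>F\<close> has multiplicity at least \<open>n\<close> at \<open>x\<close> if \<open>T\<^sup>n\<close> divides \<open>F(x + T y)\<close> in
  \<open>k[T]\<close> for every direction \<open>y\<close>. Membership of a local equation in the \<open>n\<close>-th power of the maximal
  ideal implies this (\<open>vanishes_to_order_imp_mult_at_least\<close>), so the line conditions bound the space of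
  forms from above.

  Closedness comes from linear algebra: the coefficients of \<open>T\<^sup>k\<close> in \<open>F(x + T y)\<close>, for \<open>k < \<mu>\<close>, are
  linear forms in the coefficients of \<open>F\<close> whose entries are homogeneous polynomials in \<open>x\<close>. If this
  linear system has only the trivial solution at one tuple of points, then Gaussian elimination
  without division produces a multihomogeneous polynomial that is nonzero there and certifies
  triviality wherever it is nonzero (\<open>kernel_trivial_generically\<close>).
\<close>

section \<open>Substitution into polynomials\<close>

definition is_ring_hom :: "('a::comm_ring_1 \<Rightarrow> 'b::comm_ring_1) \<Rightarrow> bool" where
  "is_ring_hom h \<longleftrightarrow> h 0 = 0 \<and> h 1 = 1 \<and> (\<forall>a b. h (a + b) = h a + h b) \<and> (\<forall>a b. h (a * b) = h a * h b)"

lemma is_ring_homD: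
  assumes "is_ring_hom h"
  shows "h 0 = 0" "h 1 = 1" "h (a + b) = h a + h b" "h (a * b) = h a * h b"
  using assms by (simp_all add: is_ring_hom_def)

lemma is_ring_hom_sum: "is_ring_hom h \<Longrightarrow> h (sum f A) = (\<Sum>a\<in>A. h (f a))"
  by (induction A rule: infinite_finite_induct) (simp_all add: is_ring_homD)

lemma is_ring_hom_prod: "is_ring_hom h \<Longrightarrow> h (prod f A) = (\<Prod>a\<in>A. h (f a))"
  by (induction A rule: infinite_finite_induct) (simp_all add: is_ring_homD)

lemma is_ring_hom_power: "is_ring_hom h \<Longrightarrow> h (a ^ n) = h a ^ n"
  by (induction n) (simp_all add: is_ring_homD)

lemma is_ring_hom_minus: "is_ring_hom h \<Longrightarrow> h (- a) = - h a"
  using is_ring_homD(3)[of h a "- a"] is_ring_homD(1)[of h] by (simp add: eq_neg_iff_add_eq_0 add.commute)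

lemma is_ring_hom_diff: "is_ring_hom h \<Longrightarrow> h (a - b) = h a - h b"
  using is_ring_homD(3)[of h a "- b"] by (simp add: is_ring_hom_minus)

lemma is_ring_hom_map_poly:
  assumes "is_ring_hom h"
  shows "is_ring_hom (map_poly h)"
proof -
  have c: "coeff (map_poly h p) n = h (coeff p n)" for p n
    by (simp add: coeff_map_poly is_ring_homD(1)[OF assms])
  show ?thesis
    unfolding is_ring_hom_def poly_eq_iff
    by (simp add: c is_ring_homD[OF assms] is_ring_hom_sum[OF assms] coeff_mult one_pCons coeff_pCons
        split: nat.splits)
qed

lemma is_ring_hom_poly: "is_ring_hom (\<lambda>p. poly p t)"
  by (simp add: is_ring_hom_def)

lemma is_ring_hom_id: "is_ring_hom (\<lambda>a. a)"
  by (simp add: is_ring_hom_def)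

lemma is_ring_hom_const_poly: "is_ring_hom (\<lambda>c. [:c:])"
  by (simp add: is_ring_hom_def one_pCons)

text \<open>
  Substitution takes values in an arbitrary commutative ring, so that one construction provides
  evaluation at points, restriction to lines (values in \<open>k[T]\<close>), and restriction to families of
  lines (values in \<open>k[W][T]\<close> or, for lines through a generic point, in a polynomial ring over a
  polynomial ring). Naturality under ring homomorphisms relates these to each other.
\<close>

definition monom_at :: "('v \<Rightarrow> 'a::comm_ring_1) \<Rightarrow> ('v \<Rightarrow>\<^sub>0 nat) \<Rightarrow> 'a" where
  "monom_at \<phi> m = (\<Prod>v\<in>Poly_Mapping.keys m. \<phi> v ^ Poly_Mapping.lookup m v)"

definition subst_into :: "('k::field \<Rightarrow> 'a::comm_ring_1) \<Rightarrow> ('v \<Rightarrow> 'a) \<Rightarrow> ('v, 'k) mpoly \<Rightarrow> 'a" where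
  "subst_into \<iota> \<phi> F = (\<Sum>m\<in>Poly_Mapping.keys F. \<iota> (Poly_Mapping.lookup F m) * monom_at \<phi> m)"

lemma monom_at_superset:
  assumes "finite A" "Poly_Mapping.keys m \<subseteq> A"
  shows "monom_at \<phi> m = (\<Prod>v\<in>A. \<phi> v ^ Poly_Mapping.lookup m v)"
  unfolding monom_at_def
  by (rule prod.mono_neutral_left) (use assms in \<open>auto simp: in_keys_iff\<close>)

lemma subst_into_superset:
  assumes "\<iota> 0 = 0" "finite A" "Poly_Mapping.keys F \<subseteq> A"
  shows "subst_into \<iota> \<phi> F = (\<Sum>m\<in>A. \<iota> (Poly_Mapping.lookup F m) * monom_at \<phi> m)"
  unfolding subst_into_def
  by (rule sum.mono_neutral_left) (use assms in \<open>auto simp: in_keys_iff\<close>)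

lemma monom_at_add: "monom_at \<phi> (m + m') = monom_at \<phi> m * monom_at \<phi> m'"
proof -
  let ?A = "Poly_Mapping.keys m \<union> Poly_Mapping.keys m'"
  have "Poly_Mapping.keys (m + m') \<subseteq> ?A"
    by (rule keys_add)
  then show ?thesis
    by (simp add: monom_at_superset[of ?A] lookup_add power_add prod.distrib)
qed

lemma monom_at_zero [simp]: "monom_at \<phi> 0 = 1"
  by (simp add: monom_at_def)

lemma subst_into_add:
  assumes "is_ring_hom \<iota>"
  shows "subst_into \<iota> \<phi> (F + G) = subst_into \<iota> \<phi> F + subst_into \<iota> \<phi> G"
proof -
  let ?A = "Poly_Mapping.keys F \<union> Poly_Mapping.keys G"
  have "Poly_Mapping.keys (F + G) \<subseteq> ?A"
    by (rule keys_add)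
  then show ?thesis
    by (simp add: subst_into_superset[of _ ?A] is_ring_homD[OF assms] lookup_add distrib_right sum.distrib)
qed

lemma subst_into_zero [simp]: "subst_into \<iota> \<phi> 0 = 0"
  by (simp add: subst_into_def)

lemma subst_into_sum:
  "is_ring_hom \<iota> \<Longrightarrow> subst_into \<iota> \<phi> (sum f A) = (\<Sum>a\<in>A. subst_into \<iota> \<phi> (f a))"
  by (induction A rule: infinite_finite_induct) (simp_all add: subst_into_add)

lemma subst_into_single:
  "is_ring_hom \<iota> \<Longrightarrow> subst_into \<iota> \<phi> (Poly_Mapping.single m c) = \<iota> c * monom_at \<phi> m"
  by (auto simp: subst_into_def is_ring_homD)

lemma sum_of_monomials:
  fixes F :: "'a \<Rightarrow>\<^sub>0 'b::comm_monoid_add"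
  shows "F = (\<Sum>m\<in>Poly_Mapping.keys F. Poly_Mapping.single m (Poly_Mapping.lookup F m))"
  by (rule poly_mapping_eqI) (simp add: lookup_sum lookup_single when_def in_keys_iff)

lemma subst_into_mult:
  fixes F G :: "('v, 'k::field) mpoly"
  assumes "is_ring_hom \<iota>"
  shows "subst_into \<iota> \<phi> (F * G) = subst_into \<iota> \<phi> F * subst_into \<iota> \<phi> G"
proof -
  have "F * G = (\<Sum>m\<in>Poly_Mapping.keys F. \<Sum>n\<in>Poly_Mapping.keys G.
                   Poly_Mapping.single (m + n) (Poly_Mapping.lookup F m * Poly_Mapping.lookup G n))"
    by (subst (1) sum_of_monomials[of F], subst (1) sum_of_monomials[of G])
      (simp only: sum_product mult_single)
  then have "subst_into \<iota> \<phi> (F * G) = (\<Sum>m\<in>Poly_Mapping.keys F. \<Sum>n\<in>Poly_Mapping.keys G.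
      \<iota> (Poly_Mapping.lookup F m * Poly_Mapping.lookup G n) * monom_at \<phi> (m + n))"
    by (simp only: subst_into_sum[OF assms] subst_into_single[OF assms])
  also have "\<dots> = subst_into \<iota> \<phi> F * subst_into \<iota> \<phi> G"
    unfolding subst_into_def sum_product
    by (simp add: monom_at_add is_ring_homD(4)[OF assms] mult_ac)
  finally show ?thesis .
qed

lemma is_ring_hom_subst_into: "is_ring_hom \<iota> \<Longrightarrow> is_ring_hom (subst_into \<iota> \<phi>)"
  by (subst is_ring_hom_def)
    (auto simp: subst_into_add subst_into_mult subst_into_single is_ring_homD simp flip: single_one)

lemma hom_monom_at: "is_ring_hom h \<Longrightarrow> h (monom_at \<phi> m) = monom_at (\<lambda>v. h (\<phi> v)) m"
  by (simp add: monom_at_def is_ring_hom_prod is_ring_hom_power)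

lemma hom_subst_into:
  "is_ring_hom h \<Longrightarrow> h (subst_into \<iota> \<phi> F) = subst_into (\<lambda>c. h (\<iota> c)) (\<lambda>v. h (\<phi> v)) F"
  by (simp add: subst_into_def is_ring_hom_sum is_ring_homD hom_monom_at)

lemma eval_eq_subst_into: "eval x F = subst_into (\<lambda>c. c) x F"
  by (simp add: eval_def subst_into_def monom_at_def)

lemma is_ring_hom_eval: "is_ring_hom (eval x)"
  unfolding eval_eq_subst_into using is_ring_hom_subst_into[OF is_ring_hom_id] .


section \<open>Multiplicity along lines\<close>

definition on_line :: "('v \<Rightarrow> 'k::field) \<Rightarrow> ('v \<Rightarrow> 'k) \<Rightarrow> ('v, 'k) mpoly \<Rightarrow> 'k poly" where
  "on_line x y = subst_into (\<lambda>c. [:c:]) (\<lambda>v. [:x v, y v:])"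

definition mult_at_least :: "nat \<Rightarrow> ('v \<Rightarrow> 'k::field) \<Rightarrow> ('v, 'k) mpoly \<Rightarrow> bool" where
  "mult_at_least n x F \<longleftrightarrow> (\<forall>y. monom 1 n dvd on_line x y F)"

lemma is_ring_hom_on_line: "is_ring_hom (on_line x y)"
  unfolding on_line_def using is_ring_hom_subst_into[OF is_ring_hom_const_poly] .

lemmas on_line_add = is_ring_homD(3)[OF is_ring_hom_on_line]
lemmas on_line_mult = is_ring_homD(4)[OF is_ring_hom_on_line]

lemma coeff_0_on_line: "coeff (on_line x y F) 0 = eval x F"
  unfolding eval_eq_subst_into on_line_def poly_0_coeff_0[symmetric]
  by (subst hom_subst_into[OF is_ring_hom_poly]) simp

lemma mult_at_least_0: "mult_at_least 0 x F"
  by (simp add: mult_at_least_def)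

text \<open>
  The base point is the point of parameter \<open>0\<close> on every line through it, so all directions impose
  the same condition.
\<close>

lemma mult_at_least_1: "mult_at_least (Suc 0) x F \<longleftrightarrow> eval x F = 0"
  by (simp add: mult_at_least_def monom_1_dvd_iff' coeff_0_on_line)

lemma mult_at_least_add:
  "mult_at_least n x F \<Longrightarrow> mult_at_least n x G \<Longrightarrow> mult_at_least n x (F + G)"
  by (simp add: mult_at_least_def on_line_add)

lemma mult_at_least_mult:
  "mult_at_least m x F \<Longrightarrow> mult_at_least n x G \<Longrightarrow> mult_at_least (m + n) x (F * G)"
  using mult_dvd_mono[of "monom 1 m" _ "monom 1 n"]
  by (auto simp: mult_at_least_def on_line_mult mult_monom)

lemma mult_at_least_mult_left: "mult_at_least n x F \<Longrightarrow> mult_at_least n x (H * F)"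
  by (simp add: mult_at_least_def on_line_mult)

text \<open>
  A polynomial with nonzero constant coefficient is a unit modulo every power of \<open>T\<close>, at least
  after inverting that coefficient.
\<close>

lemma monom_dvd_cancel_unit:
  fixes p q :: "'a::idom poly"
  assumes "monom 1 n dvd q * p" "coeff q 0 \<noteq> 0"
  shows "monom 1 n dvd p"
proof -
  have "coeff p k = 0" if "k < n" for k
    using that
  proof (induction k rule: less_induct)
    case (less k)
    have "0 = coeff (q * p) k"
      using assms(1) less.prems by (simp add: monom_1_dvd_iff')
    also have "\<dots> = (\<Sum>i\<le>k. coeff q i * coeff p (k - i))"
      by (simp add: coeff_mult)
    also have "\<dots> = (\<Sum>i\<in>{0}. coeff q i * coeff p (k - i))"
      using less by (intro sum.mono_neutral_right) auto
    finally show ?case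
      using assms(2) by simp
  qed
  then show ?thesis
    by (simp add: monom_1_dvd_iff')
qed

lemma mult_at_least_cancel:
  assumes "mult_at_least n x (H * F)" "eval x H \<noteq> 0"
  shows "mult_at_least n x F"
  using assms monom_dvd_cancel_unit unfolding mult_at_least_def on_line_mult
  by (metis coeff_0_on_line)


section \<open>The powers of the maximal ideal\<close>

lemma eval_zero [simp]: "eval x 0 = 0"
  by (rule is_ring_homD(1)[OF is_ring_hom_eval])

lemma eval_one [simp]: "eval x 1 = 1"
  by (rule is_ring_homD(2)[OF is_ring_hom_eval])

lemma eval_mult [simp]: "eval x (F * G) = eval x F * eval x G"
  by (rule is_ring_homD(4)[OF is_ring_hom_eval])

lemma eval_single: "eval x (Poly_Mapping.single m c) = c * monom_at x m"
  unfolding eval_eq_subst_into by (rule subst_into_single[OF is_ring_hom_id])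

text \<open>
  A relaxation of the powers of the maximal ideal that is visibly closed under the operations
  building those powers: only the multiplicity of the numerator and the value of the denominator at
  the point matter, and homogeneity is dropped.
\<close>

definition fract_mult_at_least :: "nat \<Rightarrow> (nat \<Rightarrow> 'k::field) \<Rightarrow> (nat, 'k) mpoly fract set" where
  "fract_mult_at_least n x = {Fract G H | G H. mult_at_least n x G \<and> eval x H \<noteq> 0}"

lemma fract_mult_at_least_add:
  assumes "a \<in> fract_mult_at_least n x" "b \<in> fract_mult_at_least n x"
  shows "a + b \<in> fract_mult_at_least n x"
proof -
  obtain G H G' H' where *: "a = Fract G H" "mult_at_least n x G" "eval x H \<noteq> 0"
      "b = Fract G' H'" "mult_at_least n x G'" "eval x H' \<noteq> 0"
    using assms by (auto simp: fract_mult_at_least_def)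
  then have "H \<noteq> 0" "H' \<noteq> 0"
    by auto
  then have "a + b = Fract (H' * G + H * G') (H * H')"
    using * by (simp add: mult_ac)
  moreover have "mult_at_least n x (H' * G + H * G')"
    using * by (intro mult_at_least_add mult_at_least_mult_left)
  ultimately show ?thesis
    using * unfolding fract_mult_at_least_def
    by (intro CollectI exI[of _ "H' * G + H * G'"] exI[of _ "H * H'"]) simp
qed

lemma fract_mult_at_least_mult:
  assumes "a \<in> fract_mult_at_least m x" "b \<in> fract_mult_at_least n x"
  shows "a * b \<in> fract_mult_at_least (m + n) x"
  using assms unfolding fract_mult_at_least_def
  by (force intro: mult_at_least_mult)

lemma fract_mult_at_least_sum:
  "(\<And>t. t < (N::nat) \<Longrightarrow> a t \<in> fract_mult_at_least n x) \<Longrightarrow> (\<Sum>t<N. a t) \<in> fract_mult_at_least n x"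
proof (induction N)
  case 0
  have "0 = Fract 0 (1 :: (nat, 'a) mpoly)"
    by (simp add: Zero_fract_def)
  moreover have "mult_at_least n x 0"
    by (simp add: mult_at_least_def is_ring_homD(1)[OF is_ring_hom_on_line])
  ultimately show ?case
    unfolding fract_mult_at_least_def by force
qed (auto intro: fract_mult_at_least_add)

lemma max_ideal_power_subset:
  assumes "x \<in> P"
  shows "max_ideal_power d P n \<subseteq> fract_mult_at_least n x"
proof (induction n)
  case 0
  show ?case
    unfolding max_ideal_power.simps local_ring_def fract_mult_at_least_def
    using assms mult_at_least_0 by blast
next
  case (Suc n)
  have "max_ideal d P \<subseteq> fract_mult_at_least (Suc 0) x"
    unfolding max_ideal_def fract_mult_at_least_def mult_at_least_1 using assms by blast
  with Suc have "a * b \<in> fract_mult_at_least (Suc n) x"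
    if "a \<in> max_ideal d P" "b \<in> max_ideal_power d P n" for a b
    using that fract_mult_at_least_mult[of a "Suc 0" x b n] by auto
  then show ?case
    by (auto simp: ideal_prod_def intro!: fract_mult_at_least_sum)
qed

text \<open>
  On a chart through the point, write the local equation of \<open>F\<close> as \<open>G / H\<close> with \<open>G\<close> of high
  multiplicity. Clearing denominators shows that \<open>H F\<close> has high multiplicity, and \<open>H\<close>, not vanishing
  at the point, can be cancelled.
\<close>

lemma vanishes_to_order_imp_mult_at_least:
  assumes "P \<in> proj_space d" "x \<in> P" "vanishes_to_order d \<delta> \<mu> P F"
  shows "mult_at_least \<mu> x F"
proof -
  obtain z where z: "P = proj_rel d `` {z}" "z \<in> coord_vectors d"
    using assms(1) by (auto simp: proj_space_def elim: quotientE)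
  then have zx: "(z, x) \<in> proj_rel d"
    using assms(2) by auto
  then have "P = proj_rel d `` {x}"
    using z(1) equiv_class_eq[OF equiv_proj_rel] by blast
  moreover have "x \<in> coord_vectors d"
    using zx by (simp add: proj_rel_def)
  ultimately have P: "P = proj_rel d `` {x}" "x \<in> coord_vectors d"
    by blast+
  obtain i where i: "i \<le> d" "x i \<noteq> 0"
    using P(2) by (auto simp: coord_vectors_def)
  have "\<forall>z\<in>P. z i \<noteq> 0"
    using P(1) i(2) by (auto simp: proj_rel_def)
  then have "Fract F (Var i ^ \<delta>) \<in> max_ideal_power d P \<mu>"
    using assms(3) i(1) by (auto simp: vanishes_to_order_def)
  then obtain G H where GH: "Fract F (Var i ^ \<delta>) = Fract G H" "mult_at_least \<mu> x G" "eval x H \<noteq> 0"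
    using subsetD[OF max_ideal_power_subset[OF assms(2)]] by (force simp: fract_mult_at_least_def)
  have "(Var i :: (nat, 'a) mpoly) \<noteq> 0"
    by (metis Var_def keys_single keys_zero insert_not_empty one_neq_zero)
  moreover have "H \<noteq> 0"
    using GH(3) by auto
  ultimately have "H * F = Var i ^ \<delta> * G"
    using GH(1) by (simp add: eq_fract mult_ac)
  then have "mult_at_least \<mu> x (H * F)"
    using GH(2) by (simp add: mult_at_least_mult_left)
  then show ?thesis
    using GH(3) by (rule mult_at_least_cancel)
qed


section \<open>Forms and hyperplanes\<close>

definition mdeg :: "('v \<Rightarrow>\<^sub>0 nat) \<Rightarrow> nat" where
  "mdeg m = (\<Sum>v\<in>Poly_Mapping.keys m. Poly_Mapping.lookup m v)"

lemma mdeg_superset: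
  assumes "finite A" "Poly_Mapping.keys m \<subseteq> A"
  shows "mdeg m = (\<Sum>v\<in>A. Poly_Mapping.lookup m v)"
  unfolding mdeg_def
  by (rule sum.mono_neutral_left) (use assms in \<open>auto simp: in_keys_iff\<close>)

lemma mdeg_add: "mdeg (m + m') = mdeg m + mdeg m'"
proof -
  let ?A = "Poly_Mapping.keys m \<union> Poly_Mapping.keys m'"
  have "Poly_Mapping.keys (m + m') \<subseteq> ?A"
    by (rule keys_add)
  then show ?thesis
    by (simp add: mdeg_superset[of ?A] lookup_add sum.distrib)
qed

lemma mdeg_zero [simp]: "mdeg 0 = 0"
  by (simp add: mdeg_def)

lemma mdeg_single [simp]: "mdeg (Poly_Mapping.single v n) = n"
  by (simp add: mdeg_def)

lemma homogeneous_iff: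
  "homogeneous d n F \<longleftrightarrow> (\<forall>m\<in>Poly_Mapping.keys F. Poly_Mapping.keys m \<subseteq> {..d} \<and> mdeg m = n)"
  by (simp add: homogeneous_def mdeg_def)

lemma homogeneous_zero [simp]: "homogeneous d n 0"
  by (simp add: homogeneous_def)

lemma homogeneous_add: "homogeneous d n F \<Longrightarrow> homogeneous d n G \<Longrightarrow> homogeneous d n (F + G)"
  using keys_add[of F G] unfolding homogeneous_def by blast

lemma homogeneous_sum:
  "(\<And>a. a \<in> A \<Longrightarrow> homogeneous d n (f a)) \<Longrightarrow> homogeneous d n (sum f A)"
  by (induction A rule: infinite_finite_induct) (auto intro: homogeneous_add)

lemma homogeneous_mult:
  assumes "homogeneous d m F" "homogeneous d n G"
  shows "homogeneous d (m + n) (F * G)"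
  unfolding homogeneous_iff
proof
  fix k
  assume "k \<in> Poly_Mapping.keys (F * G)"
  then obtain a b where "k = a + b" "a \<in> Poly_Mapping.keys F" "b \<in> Poly_Mapping.keys G"
    using keys_mult[of F G] by blast
  then show "Poly_Mapping.keys k \<subseteq> {..d} \<and> mdeg k = m + n"
    using assms keys_add[of a b] by (fastforce simp: homogeneous_iff mdeg_add)
qed

lemma homogeneous_single:
  "Poly_Mapping.keys m \<subseteq> {..d} \<Longrightarrow> mdeg m = n \<Longrightarrow> homogeneous d n (Poly_Mapping.single m a)"
  by (simp add: homogeneous_iff)

lemma homogeneous_power: "homogeneous d n F \<Longrightarrow> homogeneous d (k * n) (F ^ k)"
proof (induction k)
  case 0
  then show ?case
    using homogeneous_single[of 0 d 0 1] by simp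
qed (auto dest: homogeneous_mult)

lemma homogeneous_Var: "i \<le> d \<Longrightarrow> homogeneous d 1 (Var i)"
  by (simp add: Var_def homogeneous_single)

lemma Var_power: "Var i ^ n = Poly_Mapping.single (Poly_Mapping.single i n) 1"
  by (induction n) (simp_all add: Var_def mult_single flip: single_add single_one)

lemma on_line_single: "on_line x y (Poly_Mapping.single m a) = [:a:] * monom_at (\<lambda>v. [:x v, y v:]) m"
  unfolding on_line_def by (rule subst_into_single[OF is_ring_hom_const_poly])

lemma on_line_Var: "on_line x y (Var i) = [:x i, y i:]"
  by (simp add: Var_def on_line_single monom_at_def)

lemma on_line_cong:
  assumes "homogeneous d n F" "\<And>i. i \<le> d \<Longrightarrow> x i = x' i" "\<And>i. i \<le> d \<Longrightarrow> y i = y' i"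
  shows "on_line x y F = on_line x' y' F"
  unfolding on_line_def subst_into_def monom_at_def
proof (intro sum.cong prod.cong arg_cong2[where f = "(*)"] refl)
  fix m v
  assume "m \<in> Poly_Mapping.keys F" "v \<in> Poly_Mapping.keys m"
  then have "v \<le> d"
    using assms(1) by (auto simp: homogeneous_def)
  then show "[:x v, y v:] ^ Poly_Mapping.lookup m v = [:x' v, y' v:] ^ Poly_Mapping.lookup m v"
    using assms(2,3) by simp
qed

definition hyperplane :: "'k::field \<Rightarrow> nat \<Rightarrow> (nat, 'k) mpoly" where
  "hyperplane c i = Var i - Poly_Mapping.single 0 c * Var 0"

lemma on_line_hyperplane: "on_line x y (hyperplane c i) = [:x i - c * x 0, y i - c * y 0:]"
  by (simp add: hyperplane_def is_ring_hom_diff[OF is_ring_hom_on_line] on_line_mult on_line_Var on_line_single)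

lemma eval_hyperplane: "eval x (hyperplane c i) = x i - c * x 0"
  by (simp add: on_line_hyperplane flip: coeff_0_on_line[of x "\<lambda>_. 0"])

text \<open>
  Division with remainder by \<open>X\<^sub>d\<^sub>+\<^sub>1 - c X\<^sub>0\<close>: replacing \<open>X\<^sub>d\<^sub>+\<^sub>1\<close> by \<open>c X\<^sub>0\<close> in a monomial gives the
  remainder, and the factorisation of \<open>A\<^sup>n - B\<^sup>n\<close> gives the quotient. Subtraction on natural
  numbers makes \<open>\<delta> - 1\<close> meaningless for \<open>\<delta> = 0\<close>, whence the separate clause that the quotient is then zero.
\<close>

lemma homogeneous_divide_monomial:
  fixes a c :: "'k::field"
  assumes "Poly_Mapping.keys m \<subseteq> {..Suc d}" "mdeg m = \<delta>"
  shows "\<exists>G Q. homogeneous d \<delta> G \<and> homogeneous (Suc d) (\<delta> - 1) Q \<and> (\<delta> = 0 \<longrightarrow> Q = 0) \<and>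
               Poly_Mapping.single m a = G + hyperplane c (Suc d) * Q"
proof -
  define n where "n = Poly_Mapping.lookup m (Suc d)"
  define m' where "m' = Poly_Mapping.update (Suc d) 0 m"
  have m: "m = m' + Poly_Mapping.single (Suc d) n"
    by (rule poly_mapping_eqI)
      (auto simp: m'_def n_def lookup_add lookup_update lookup_single when_def)
  have km: "Poly_Mapping.keys m' \<subseteq> {..d}"
  proof
    fix v
    assume "v \<in> Poly_Mapping.keys m'"
    then have "v \<noteq> Suc d" "v \<in> Poly_Mapping.keys m"
      by (auto simp: m'_def keys_update)
    then show "v \<in> {..d}"
      using assms(1) by fastforce
  qed
  have deg: "mdeg m' + n = \<delta>"
    using assms(2) arg_cong[OF m, of mdeg] by (simp add: mdeg_add)
  let ?A = "Var (Suc d) :: (nat, 'k) mpoly" and ?B = "Poly_Mapping.single 0 c * Var 0 :: (nat, 'k) mpoly"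
  define G where "G = Poly_Mapping.single m' a * ?B ^ n"
  define Q where "Q = Poly_Mapping.single m' a * (\<Sum>i<n. ?B ^ (n - Suc i) * ?A ^ i)"
  have "Poly_Mapping.single m a = Poly_Mapping.single m' a * ?A ^ n"
    unfolding Var_power mult_single by (simp flip: m)
  also have "\<dots> = G + Poly_Mapping.single m' a * (?A ^ n - ?B ^ n)"
    by (simp add: G_def algebra_simps)
  also have "\<dots> = G + hyperplane c (Suc d) * Q"
    unfolding power_diff_sumr2 Q_def hyperplane_def by (simp add: mult_ac)
  finally have eq: "Poly_Mapping.single m a = G + hyperplane c (Suc d) * Q" .
  have B: "homogeneous e 1 ?B" for e
    using homogeneous_mult[OF homogeneous_single[of 0 e 0 c] homogeneous_Var[of 0 e]] by simp
  have "homogeneous d (mdeg m' + n * 1) G"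
    unfolding G_def by (intro homogeneous_mult homogeneous_single homogeneous_power B km refl)
  moreover have "homogeneous (Suc d) (\<delta> - 1) Q" "\<delta> = 0 \<longrightarrow> Q = 0"
  proof -
    have "homogeneous (Suc d) (n - 1) (?B ^ (n - Suc i) * ?A ^ i)" if "i < n" for i
    proof -
      have "homogeneous (Suc d) ((n - Suc i) * 1 + i * 1) (?B ^ (n - Suc i) * ?A ^ i)"
        by (intro homogeneous_mult homogeneous_power B homogeneous_Var) simp
      then show ?thesis
        using that by simp
    qed
    then have "homogeneous (Suc d) (mdeg m' + (n - 1)) Q"
      unfolding Q_def using km by (intro homogeneous_mult homogeneous_single homogeneous_sum) auto
    moreover have "n = 0 \<Longrightarrow> Q = 0"
      by (simp add: Q_def)
    ultimately show "homogeneous (Suc d) (\<delta> - 1) Q" "\<delta> = 0 \<longrightarrow> Q = 0"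
      using deg by (cases n; auto)+
  qed
  ultimately show ?thesis
    using eq deg by (metis nat_mult_1_right)
qed

text \<open>
  The remainder \<open>G\<close> is the restriction of \<open>F\<close> to the hyperplane, with coordinates \<open>X\<^sub>0, \<dots>, X\<^sub>d\<close>.
\<close>

lemma homogeneous_divide:
  fixes F :: "(nat, 'k::field) mpoly"
  assumes "homogeneous (Suc d) \<delta> F"
  obtains G Q where "homogeneous d \<delta> G" "homogeneous (Suc d) (\<delta> - 1) Q" "\<delta> = 0 \<Longrightarrow> Q = 0"
    "F = G + hyperplane c (Suc d) * Q"
proof -
  have "\<forall>m\<in>Poly_Mapping.keys F. \<exists>G Q. homogeneous d \<delta> G \<and> homogeneous (Suc d) (\<delta> - 1) Q \<and> (\<delta> = 0 \<longrightarrow> Q = 0) \<and>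
               Poly_Mapping.single m (Poly_Mapping.lookup F m) = G + hyperplane c (Suc d) * Q"
    using assms[unfolded homogeneous_iff] by (intro ballI homogeneous_divide_monomial) auto
  then obtain G Q where GQ: "\<And>m. m \<in> Poly_Mapping.keys F \<Longrightarrow>
      homogeneous d \<delta> (G m) \<and> homogeneous (Suc d) (\<delta> - 1) (Q m) \<and> (\<delta> = 0 \<longrightarrow> Q m = 0) \<and>
      Poly_Mapping.single m (Poly_Mapping.lookup F m) = G m + hyperplane c (Suc d) * Q m"
    by metis
  have "F = (\<Sum>m\<in>Poly_Mapping.keys F. G m + hyperplane c (Suc d) * Q m)"
    by (subst sum_of_monomials) (use GQ in \<open>auto intro!: sum.cong\<close>)
  then have "F = (\<Sum>m\<in>Poly_Mapping.keys F. G m) + hyperplane c (Suc d) * (\<Sum>m\<in>Poly_Mapping.keys F. Q m)"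
    by (simp add: sum.distrib sum_distrib_left)
  then show ?thesis
    using GQ by (intro that[of "\<Sum>m\<in>Poly_Mapping.keys F. G m" "\<Sum>m\<in>Poly_Mapping.keys F. Q m"])
      (auto intro!: homogeneous_sum sum.neutral)
qed

text \<open>
  Each coefficient of \<open>F(x + T (y + w e))\<close> is a polynomial in \<open>w\<close>; over an infinite field it is zero
  if it vanishes for all \<open>w \<noteq> 0\<close>. Hence the direction \<open>y\<close> inherits a divisibility that holds
  for all other directions \<open>y + w e\<close>.
\<close>

lemma monom_dvd_on_line_limit:
  fixes F :: "('v, 'k::field) mpoly"
  assumes inf: "infinite (UNIV :: 'k set)"
    and dvd: "\<And>w. w \<noteq> 0 \<Longrightarrow> monom 1 n dvd on_line x (\<lambda>v. y v + w * e v) F"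
  shows "monom 1 n dvd on_line x y F"
proof -
  define Q where "Q = subst_into (\<lambda>c. [:[:c:]:]) (\<lambda>v. [:[:x v:], [:y v, e v:]:]) F"
  have "map_poly (\<lambda>q. poly q w) Q = on_line x (\<lambda>v. y v + w * e v) F" for w
    unfolding Q_def on_line_def hom_subst_into[OF is_ring_hom_map_poly[OF is_ring_hom_poly]]
    by (simp add: map_poly_pCons)
  then have Q: "poly (coeff Q k) w = coeff (on_line x (\<lambda>v. y v + w * e v) F) k" for k w
    by (metis coeff_map_poly poly_0)
  have "coeff (on_line x y F) k = 0" if "k < n" for k
  proof -
    have "UNIV - {0} \<subseteq> {w. poly (coeff Q k) w = 0}"
      using dvd that by (auto simp: Q monom_1_dvd_iff')
    then have "infinite {w. poly (coeff Q k) w = 0}"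
      using inf by (meson finite_Diff2 finite.emptyI finite.insertI finite_subset)
    then have "coeff Q k = 0"
      using poly_roots_finite by blast
    then show ?thesis
      using Q[of k 0] by simp
  qed
  then show ?thesis
    by (simp add: monom_1_dvd_iff')
qed

text \<open>
  Along a line transversal to the hyperplane, the linear form contributes exactly one factor \<open>T\<close>. A
  line inside the hyperplane gives no information about the quotient, but it is a limit of
  transversal ones.
\<close>

lemma mult_at_least_divide_hyperplane:
  fixes F :: "(nat, 'k::field) mpoly"
  assumes inf: "infinite (UNIV :: 'k set)" and i: "i \<noteq> 0" and x: "x i = c * x 0"
    and F: "mult_at_least (Suc n) x (hyperplane c i * F)"
  shows "mult_at_least n x F"
  unfolding mult_at_least_def
proof
  have *: "monom 1 n dvd on_line x y F" if y: "y i \<noteq> c * y 0" for y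
  proof -
    have "monom 1 (Suc n) dvd [:0, y i - c * y 0:] * on_line x y F"
      using F x by (simp add: mult_at_least_def on_line_mult on_line_hyperplane del: mult_pCons_left)
    then have "\<forall>k<n. (y i - c * y 0) * coeff (on_line x y F) k = 0"
      by (auto simp: monom_1_dvd_iff')
    then show ?thesis
      using y by (simp add: monom_1_dvd_iff')
  qed
  fix y
  show "monom 1 n dvd on_line x y F"
  proof (cases "y i = c * y 0")
    case True
    \<comment> \<open>Tilting the direction along the \<open>i\<close>-th axis leaves the hyperplane, since \<open>i \<noteq> 0\<close>.\<close>
    show ?thesis
      by (rule monom_dvd_on_line_limit[OF inf, where e = "\<lambda>v. if v = i then 1 else 0"])
        (use True i in \<open>auto intro!: *\<close>)
  qed (rule *)
qed


section \<open>Forms with multiple points on a grid\<close>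

text \<open>
  The descent on the degree, with the statement for one dimension less as hypothesis \<open>IH\<close>. The
  multiplicity \<open>M c\<close> may vary with the hyperplane \<open>X\<^sub>d\<^sub>+\<^sub>1 = c X\<^sub>0\<close>, because dividing by one
  of these linear forms lowers the multiplicity on that hyperplane alone. Choosing \<open>c\<close> with \<open>M c\<close>
  largest bounds \<open>\<delta>\<close> by \<open>card S * M c\<close>, which is what \<open>IH\<close> asks of the restriction.
\<close>

lemma form_zero_if_mult_on_parallel_layers:
  fixes S :: "'k::field set"
  assumes inf: "infinite (UNIV :: 'k set)" and S: "finite S"
    and IH: "\<And>\<delta> F \<mu>. homogeneous d \<delta> F \<Longrightarrow>
          (\<And>x. x 0 = 1 \<Longrightarrow> (\<forall>j\<in>{1..d}. x j \<in> S) \<Longrightarrow> mult_at_least \<mu> x F) \<Longrightarrow>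
          \<delta> < card S * \<mu> \<Longrightarrow> F = 0"
  shows "homogeneous (Suc d) \<delta> F \<Longrightarrow>
          (\<And>x. x 0 = 1 \<Longrightarrow> (\<forall>j\<in>{1..Suc d}. x j \<in> S) \<Longrightarrow> mult_at_least (M (x (Suc d))) x F) \<Longrightarrow>
          \<delta> < (\<Sum>c\<in>S. M c) \<Longrightarrow> F = 0"
proof (induction \<delta> arbitrary: F M rule: less_induct)
  case (less \<delta> F M)
  have "S \<noteq> {}"
    using less.prems(3) by auto
  then obtain c where c: "c \<in> S" "\<And>b. b \<in> S \<Longrightarrow> M b \<le> M c"
    using S Max_in[of "M ` S"] Max_ge[of "M ` S"] by (metis (no_types, lifting) finite_imageI imageE imageI image_is_empty)
  obtain G Q where GQ: "homogeneous d \<delta> G" "homogeneous (Suc d) (\<delta> - 1) Q" "\<delta> = 0 \<Longrightarrow> Q = 0"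
    and F: "F = G + hyperplane c (Suc d) * Q"
    using homogeneous_divide[OF less.prems(1)] by metis
  have "G = 0"
  proof (rule IH[OF GQ(1)])
    fix x :: "nat \<Rightarrow> 'k"
    assume x: "x 0 = 1" "\<forall>j\<in>{1..d}. x j \<in> S"
    show "mult_at_least (M c) x G"
      unfolding mult_at_least_def
    proof
      fix y :: "nat \<Rightarrow> 'k"
      let ?x = "x(Suc d := c)" and ?y = "y(Suc d := c * y 0)"
      have "on_line x y G = on_line ?x ?y G"
        by (rule on_line_cong[OF GQ(1)]) auto
      also have "\<dots> = on_line ?x ?y F"
        using x(1) by (simp add: F on_line_add on_line_mult on_line_hyperplane)
      also have "monom 1 (M c) dvd \<dots>"
      proof -
        have "\<forall>j\<in>{1..Suc d}. ?x j \<in> S"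
          using x(2) c(1) by (auto simp: le_Suc_eq)
        then have "mult_at_least (M (?x (Suc d))) ?x F"
          using x(1) by (intro less.prems(2)) simp_all
        then show ?thesis
          unfolding mult_at_least_def by simp
      qed
      finally show "monom 1 (M c) dvd on_line x y G" .
    qed
  next
    have "sum M S \<le> card S * M c"
      using sum_bounded_above[of S M "M c"] c(2) by simp
    then show "\<delta> < card S * M c"
      using less.prems(3) by simp
  qed
  then have F: "F = hyperplane c (Suc d) * Q"
    using F by simp
  show ?case
  proof (cases "\<delta> = 0")
    case True
    then show ?thesis
      using F GQ(3) by simp
  next
    case False
    have "M c > 0"
      using less.prems(3) c(2) by (metis gr0I le_zero_eq not_less_zero sum.neutral)
    define M' where "M' = M(c := M c - 1)"
    have "sum M S = M c + sum M (S - {c})" "sum M' S = M' c + sum M' (S - {c})"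
      using S c(1) by (simp_all add: sum.remove)
    moreover have "sum M' (S - {c}) = sum M (S - {c})"
      by (rule sum.cong) (auto simp: M'_def)
    ultimately have lt: "\<delta> - 1 < sum M' S"
      using less.prems(3) \<open>M c > 0\<close> False by (simp add: M'_def)
    have "Q = 0"
    proof (rule less.IH[OF _ GQ(2) _ lt])
      fix x :: "nat \<Rightarrow> 'k"
      assume x: "x 0 = 1" "\<forall>j\<in>{1..Suc d}. x j \<in> S"
      have mult: "mult_at_least (M (x (Suc d))) x (hyperplane c (Suc d) * Q)"
        using less.prems(2)[OF x] by (simp add: F)
      show "mult_at_least (M' (x (Suc d))) x Q"
      proof (cases "x (Suc d) = c")
        case True
        have "mult_at_least (M c - 1) x Q"
          by (rule mult_at_least_divide_hyperplane[OF inf, of "Suc d" x c])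
            (use True mult x(1) \<open>M c > 0\<close> in auto)
        then show ?thesis
          by (simp add: M'_def True)
      next
        case False
        then have "mult_at_least (M (x (Suc d))) x Q"
          using x(1) by (intro mult_at_least_cancel[OF mult]) (simp add: eval_hyperplane)
        then show ?thesis
          using False by (simp add: M'_def)
      qed
    qed (use False in simp)
    then show ?thesis
      by (simp add: F)
  qed
qed

text \<open>
  The coordinates \<open>x j\<close> with \<open>j > d\<close> are left free, since forms in \<open>X\<^sub>0, \<dots>, X\<^sub>d\<close> do not see them.
  This spares any normalisation when passing between dimensions \<open>d\<close> and \<open>d + 1\<close>.
\<close>

lemma form_zero_if_mult_on_grid:
  fixes S :: "'k::field set"
  assumes inf: "infinite (UNIV :: 'k set)" and S: "finite S"
  shows "homogeneous d \<delta> F \<Longrightarrow>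
          (\<And>x. x 0 = 1 \<Longrightarrow> (\<forall>j\<in>{1..d}. x j \<in> S) \<Longrightarrow> mult_at_least \<mu> x F) \<Longrightarrow>
          \<delta> < card S * \<mu> \<Longrightarrow> F = 0"
proof (induction d arbitrary: \<delta> F \<mu>)
  case (0 \<delta> F \<mu>)
  let ?m = "Poly_Mapping.single 0 \<delta> :: nat \<Rightarrow>\<^sub>0 nat"
  have "\<mu> > 0"
    using 0(3) by (cases \<mu>) auto
  have "m = ?m" if "m \<in> Poly_Mapping.keys F" for m
  proof (rule poly_mapping_eqI)
    fix k
    have "Poly_Mapping.keys m \<subseteq> {0}" "mdeg m = \<delta>"
      using 0(1) that by (auto simp: homogeneous_iff)
    then show "Poly_Mapping.lookup m k = Poly_Mapping.lookup ?m k"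
      using mdeg_superset[of "{0}" m] by (auto simp: lookup_single when_def in_keys_iff)
  qed
  then have F: "F = Poly_Mapping.single ?m (Poly_Mapping.lookup F ?m)"
    by (intro poly_mapping_eqI) (auto simp: lookup_single when_def in_keys_iff)
  have "mult_at_least \<mu> (\<lambda>_. 1) F"
    using 0(2)[of "\<lambda>_. 1"] by simp
  then have "coeff (on_line (\<lambda>_. 1) (\<lambda>_. 0) F) 0 = 0"
    using \<open>\<mu> > 0\<close> by (simp add: mult_at_least_def monom_1_dvd_iff')
  then have "Poly_Mapping.lookup F ?m = 0"
    unfolding coeff_0_on_line by (subst (asm) F) (simp add: eval_single monom_at_def)
  then show ?case
    using F by simp
next
  case (Suc d \<delta> F \<mu>)
  show ?case
    by (rule form_zero_if_mult_on_parallel_layers[OF inf S Suc.IH, where M = "\<lambda>_. \<mu>"]) (use Suc.prems in auto)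
qed


section \<open>Generic triviality of kernels\<close>

definition has_multidegree :: "nat \<Rightarrow> nat \<Rightarrow> (nat \<Rightarrow> nat) \<Rightarrow> (nat \<times> nat, 'k::field) mpoly \<Rightarrow> bool" where
  "has_multidegree d r e G \<longleftrightarrow>
     (\<forall>m\<in>Poly_Mapping.keys G. Poly_Mapping.keys m \<subseteq> {..<r} \<times> {..d} \<and>
        (\<forall>i<r. (\<Sum>j\<le>d. Poly_Mapping.lookup m (i, j)) = e i))"

lemma multihomogeneous_iff: "multihomogeneous d r G \<longleftrightarrow> (\<exists>e. has_multidegree d r e G)"
  by (simp add: multihomogeneous_def has_multidegree_def)

lemma has_multidegree_one: "has_multidegree d r (\<lambda>_. 0) 1"
  by (simp add: has_multidegree_def)

lemma has_multidegree_mult: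
  assumes "has_multidegree d r e F" "has_multidegree d r e' G"
  shows "has_multidegree d r (\<lambda>i. e i + e' i) (F * G)"
  unfolding has_multidegree_def
proof
  fix k
  assume "k \<in> Poly_Mapping.keys (F * G)"
  then obtain a b where ab: "k = a + b" "a \<in> Poly_Mapping.keys F" "b \<in> Poly_Mapping.keys G"
    using keys_mult[of F G] by blast
  then have "Poly_Mapping.keys a \<subseteq> {..<r} \<times> {..d}" "Poly_Mapping.keys b \<subseteq> {..<r} \<times> {..d}"
    using assms by (auto simp: has_multidegree_def)
  then have "Poly_Mapping.keys k \<subseteq> {..<r} \<times> {..d}"
    using keys_add[of a b] ab(1) by blast
  then show "Poly_Mapping.keys k \<subseteq> {..<r} \<times> {..d} \<and>
        (\<forall>i<r. (\<Sum>j\<le>d. Poly_Mapping.lookup k (i, j)) = e i + e' i)"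
    using assms ab by (simp add: has_multidegree_def lookup_add sum.distrib)
qed

lemma has_multidegree_diff:
  assumes "has_multidegree d r e F" "has_multidegree d r e G"
  shows "has_multidegree d r e (F - G)"
proof -
  have "Poly_Mapping.keys (F - G) \<subseteq> Poly_Mapping.keys F \<union> Poly_Mapping.keys G"
    by (auto simp: in_keys_iff lookup_minus)
  then show ?thesis
    using assms unfolding has_multidegree_def by blast
qed

text \<open>
  Gaussian elimination without division. At \<open>z\<close> some row \<open>\<pi>\<close> has a nonzero entry in column \<open>c\<close>, as
  otherwise the unit vector at \<open>c\<close> would be in the kernel. Replacing each row \<open>\<rho>\<close> by \<open>\<pi>\<^sub>c \<rho> - \<rho>\<^sub>c \<pi>\<close>
  clears that column, and the polynomial \<open>D\<close> is the product of the successive pivots. The set of rows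
  may be infinite, and different rows may have different multidegrees; it is only required that
  the entries of one row share theirs, which the elimination step preserves.
\<close>

lemma kernel_trivial_generically:
  fixes R :: "('c \<Rightarrow> (nat \<times> nat, 'k::field) mpoly) set"
  assumes "finite C"
    and "\<And>\<rho>. \<rho> \<in> R \<Longrightarrow> \<exists>e. \<forall>c\<in>C. has_multidegree d r e (\<rho> c)"
    and "\<And>u. \<forall>\<rho>\<in>R. (\<Sum>c\<in>C. eval z (\<rho> c) * u c) = 0 \<Longrightarrow> \<forall>c\<in>C. u c = 0"
  shows "\<exists>D e. has_multidegree d r e D \<and> eval z D \<noteq> 0 \<and>
           (\<forall>x u. eval x D \<noteq> 0 \<longrightarrow> (\<forall>\<rho>\<in>R. (\<Sum>c\<in>C. eval x (\<rho> c) * u c) = 0) \<longrightarrow> (\<forall>c\<in>C. u c = 0))"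
  using assms
proof (induction C arbitrary: R rule: finite_induct)
  case empty
  show ?case
    by (intro exI[of _ 1] exI[of _ "\<lambda>_. 0"]) (simp add: has_multidegree_one)
next
  case (insert c C R)
  note ker = insert.prems(2)
  have "\<exists>\<rho>\<in>R. eval z (\<rho> c) \<noteq> 0"
  proof (rule ccontr)
    assume "\<not> ?thesis"
    then have "\<forall>\<rho>\<in>R. (\<Sum>b\<in>insert c C. eval z (\<rho> b) * (if b = c then 1 else 0)) = 0"
      by (simp add: if_distrib[of "(*) _"] sum.delta' insert.hyps cong: if_cong)
    from ker[OF this] show False
      by simp
  qed
  then obtain \<pi> where \<pi>: "\<pi> \<in> R" "eval z (\<pi> c) \<noteq> 0"
    by blast
  define elim where "elim \<rho> = (\<lambda>b. \<pi> c * \<rho> b - \<rho> c * \<pi> b)" for \<rho>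
  have elim: "(\<Sum>b\<in>C. eval x (elim \<rho> b) * u b) =
      eval x (\<pi> c) * (\<Sum>b\<in>C. eval x (\<rho> b) * u b) - eval x (\<rho> c) * (\<Sum>b\<in>C. eval x (\<pi> b) * u b)"
    for x u \<rho>
    by (simp add: elim_def is_ring_hom_diff[OF is_ring_hom_eval] sum_distrib_left sum_subtractf
        algebra_simps)
  have "\<exists>D e. has_multidegree d r e D \<and> eval z D \<noteq> 0 \<and>
           (\<forall>x u. eval x D \<noteq> 0 \<longrightarrow> (\<forall>\<rho>\<in>elim ` R. (\<Sum>c\<in>C. eval x (\<rho> c) * u c) = 0) \<longrightarrow> (\<forall>c\<in>C. u c = 0))"
  proof (rule insert.IH)
    fix \<sigma>
    assume "\<sigma> \<in> elim ` R"
    then obtain \<rho> where \<rho>: "\<rho> \<in> R" "\<sigma> = elim \<rho>"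
      by blast
    obtain e e' where e: "\<forall>b\<in>insert c C. has_multidegree d r e (\<pi> b)"
        "\<forall>b\<in>insert c C. has_multidegree d r e' (\<rho> b)"
      using insert.prems(1) \<pi>(1) \<rho>(1) by meson
    have "has_multidegree d r (\<lambda>i. e i + e' i) (\<sigma> b)" if "b \<in> C" for b
      unfolding \<rho>(2) elim_def
    proof (rule has_multidegree_diff)
      show "has_multidegree d r (\<lambda>i. e i + e' i) (\<pi> c * \<rho> b)"
        using e that by (intro has_multidegree_mult) auto
      have "has_multidegree d r (\<lambda>i. e i + e' i) (\<pi> b * \<rho> c)"
        using e that by (intro has_multidegree_mult) auto
      then show "has_multidegree d r (\<lambda>i. e i + e' i) (\<rho> c * \<pi> b)"
        by (simp add: mult.commute)
    qed
    then show "\<exists>e. \<forall>b\<in>C. has_multidegree d r e (\<sigma> b)"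
      by blast
  next
    fix u
    assume u: "\<forall>\<sigma>\<in>elim ` R. (\<Sum>b\<in>C. eval z (\<sigma> b) * u b) = 0"
    \<comment> \<open>The entry at \<open>c\<close> is chosen such that the extended vector is annihilated by the row \<open>\<pi>\<close>.\<close>
    define s where "s = (\<Sum>b\<in>C. eval z (\<pi> b) * u b)"
    define u' where "u' = u(c := - s / eval z (\<pi> c))"
    have sum_u': "(\<Sum>b\<in>insert c C. eval z (\<rho> b) * u' b) =
        (\<Sum>b\<in>C. eval z (\<rho> b) * u b) - eval z (\<rho> c) * s / eval z (\<pi> c)" for \<rho>
    proof -
      have "(\<Sum>b\<in>C. eval z (\<rho> b) * u' b) = (\<Sum>b\<in>C. eval z (\<rho> b) * u b)"
        using insert.hyps by (intro sum.cong) (auto simp: u'_def)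
      then show ?thesis
        using insert.hyps by (simp add: u'_def)
    qed
    have "\<forall>\<rho>\<in>R. (\<Sum>b\<in>insert c C. eval z (\<rho> b) * u' b) = 0"
    proof
      fix \<rho>
      assume "\<rho> \<in> R"
      then have "eval z (\<pi> c) * (\<Sum>b\<in>C. eval z (\<rho> b) * u b) = eval z (\<rho> c) * s"
        using u elim[of z \<rho> u] by (simp add: s_def)
      then show "(\<Sum>b\<in>insert c C. eval z (\<rho> b) * u' b) = 0"
        unfolding sum_u' using \<pi>(2) by (simp add: field_simps)
    qed
    from ker[OF this] show "\<forall>b\<in>C. u b = 0"
      using insert.hyps by (auto simp: u'_def split: if_splits)
  qed
  then obtain D e where D: "has_multidegree d r e D" "eval z D \<noteq> 0"
    "\<And>x u. eval x D \<noteq> 0 \<Longrightarrow> \<forall>\<rho>\<in>elim ` R. (\<Sum>c\<in>C. eval x (\<rho> c) * u c) = 0 \<Longrightarrow> \<forall>c\<in>C. u c = 0"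
    by blast
  obtain e' where e': "has_multidegree d r e' (\<pi> c)"
    using insert.prems(1)[OF \<pi>(1)] by auto
  show ?case
  proof (intro exI conjI allI impI)
    show "has_multidegree d r (\<lambda>i. e' i + e i) (\<pi> c * D)"
      by (rule has_multidegree_mult[OF e' D(1)])
    show "eval z (\<pi> c * D) \<noteq> 0"
      using D(2) \<pi>(2) by simp
    fix x u
    assume x: "eval x (\<pi> c * D) \<noteq> 0"
      and u: "\<forall>\<rho>\<in>R. (\<Sum>b\<in>insert c C. eval x (\<rho> b) * u b) = 0"
    have C: "(\<Sum>b\<in>C. eval x (\<rho> b) * u b) = - eval x (\<rho> c) * u c" if "\<rho> \<in> R" for \<rho>
      using u that insert.hyps by (simp add: eq_neg_iff_add_eq_0 add.commute)
    have "\<forall>\<sigma>\<in>elim ` R. (\<Sum>b\<in>C. eval x (\<sigma> b) * u b) = 0"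
      using \<pi>(1) by (auto simp: elim C)
    then have "\<forall>b\<in>C. u b = 0"
      using x by (intro D(3)[of x u]) simp_all
    moreover from this have "u c = 0"
      using C[OF \<pi>(1)] x by simp
    ultimately show "\<forall>b\<in>insert c C. u b = 0"
      by simp
  qed
qed


section \<open>Semicontinuity of the multiplicity conditions\<close>

text \<open>
  The line through the \<open>i\<close>-th point, with indeterminate coordinates, in the fixed direction \<open>y\<close>.
\<close>

definition generic_line :: "nat \<Rightarrow> (nat \<Rightarrow> 'k::field) \<Rightarrow> nat \<Rightarrow> (nat \<times> nat, 'k) mpoly poly" where
  "generic_line i y v = [:Poly_Mapping.single (Poly_Mapping.single (i, v) 1) 1, Poly_Mapping.single 0 (y v):]"

lemma eval_coeff_generic_line:
  "eval (\<lambda>(i, j). x i j) (coeff (monom_at (generic_line i y) m) k) =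
     coeff (monom_at (\<lambda>v. [:x i v, y v:]) m) k"
proof -
  let ?h = "eval (\<lambda>(i, j). x i j)"
  have "?h (coeff (monom_at (generic_line i y) m) k) = coeff (map_poly ?h (monom_at (generic_line i y) m)) k"
    by (simp add: coeff_map_poly)
  also have "map_poly ?h (monom_at (generic_line i y) m) = monom_at (\<lambda>v. map_poly ?h (generic_line i y v)) m"
    by (rule hom_monom_at[OF is_ring_hom_map_poly[OF is_ring_hom_eval]])
  also have "(\<lambda>v. map_poly ?h (generic_line i y v)) = (\<lambda>v. [:x i v, y v:])"
    by (simp add: generic_line_def map_poly_pCons eval_single monom_at_def)
  finally show ?thesis .
qed

text \<open>
  Homogeneity of degree \<open>n\<close> in the coordinates of the \<open>i\<close>-th point and \<open>T\<close> together. In this grading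
  both terms of the coordinate \<open>X\<^sub>i\<^sub>v + T y\<^sub>v\<close> of a generic line have degree \<open>1\<close>.
\<close>

definition bihomogeneous :: "nat \<Rightarrow> nat \<Rightarrow> nat \<Rightarrow> (nat \<times> nat, 'k::field) mpoly poly \<Rightarrow> bool" where
  "bihomogeneous d i n p \<longleftrightarrow>
     (\<forall>k. \<forall>m\<in>Poly_Mapping.keys (coeff p k). Poly_Mapping.keys m \<subseteq> {i} \<times> {..d} \<and> mdeg m + k = n)"

lemma bihomogeneous_one: "bihomogeneous d i 0 1"
  by (auto simp: bihomogeneous_def one_pCons coeff_pCons split: nat.splits)

lemma bihomogeneous_mult:
  fixes p q :: "(nat \<times> nat, 'k::field) mpoly poly"
  assumes "bihomogeneous d i n p" "bihomogeneous d i n' q"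
  shows "bihomogeneous d i (n + n') (p * q)"
  unfolding bihomogeneous_def
proof (intro allI ballI)
  fix k m
  assume "m \<in> Poly_Mapping.keys (coeff (p * q) k)"
  then have "Poly_Mapping.lookup (\<Sum>l\<le>k. coeff p l * coeff q (k - l)) m \<noteq> 0"
    by (simp add: coeff_mult in_keys_iff)
  then obtain l where "l \<le> k" "m \<in> Poly_Mapping.keys (coeff p l * coeff q (k - l))"
    unfolding lookup_sum in_keys_iff by (metis (mono_tags, lifting) atMost_iff sum.neutral)
  then obtain a b where ab: "l \<le> k" "m = a + b" "a \<in> Poly_Mapping.keys (coeff p l)"
      "b \<in> Poly_Mapping.keys (coeff q (k - l))"
    using keys_mult[of "coeff p l" "coeff q (k - l)"] by blast
  then have "Poly_Mapping.keys a \<subseteq> {i} \<times> {..d}" "mdeg a + l = n"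
    "Poly_Mapping.keys b \<subseteq> {i} \<times> {..d}" "mdeg b + (k - l) = n'"
    using assms unfolding bihomogeneous_def by blast+
  then show "Poly_Mapping.keys m \<subseteq> {i} \<times> {..d} \<and> mdeg m + k = n + n'"
    using ab(1,2) keys_add[of a b] by (auto simp: mdeg_add)
qed

lemma bihomogeneous_power: "bihomogeneous d i n p \<Longrightarrow> bihomogeneous d i (k * n) (p ^ k)"
  by (induction k) (auto simp: bihomogeneous_one dest: bihomogeneous_mult)

lemma bihomogeneous_prod:
  "(\<And>a. a \<in> A \<Longrightarrow> bihomogeneous d i (n a) (f a)) \<Longrightarrow> bihomogeneous d i (sum n A) (prod f A)"
  by (induction A rule: infinite_finite_induct) (auto simp: bihomogeneous_one bihomogeneous_mult)

lemma bihomogeneous_generic_line: "v \<le> d \<Longrightarrow> bihomogeneous d i 1 (generic_line i y v)"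
  by (auto simp: bihomogeneous_def generic_line_def coeff_pCons split: nat.splits if_splits)

lemma bihomogeneous_monom_at_generic_line:
  assumes "Poly_Mapping.keys m \<subseteq> {..d}"
  shows "bihomogeneous d i (mdeg m) (monom_at (generic_line i y) m)"
proof -
  have "bihomogeneous d i (Poly_Mapping.lookup m v) (generic_line i y v ^ Poly_Mapping.lookup m v)"
    if "v \<in> Poly_Mapping.keys m" for v
    using bihomogeneous_power[OF bihomogeneous_generic_line[of v d i y], of "Poly_Mapping.lookup m v"]
      that assms by auto
  then show ?thesis
    unfolding mdeg_def monom_at_def by (rule bihomogeneous_prod)
qed

lemma has_multidegree_coeff:
  assumes "bihomogeneous d i n p" "i < r"
  shows "has_multidegree d r (\<lambda>i'. if i' = i then n - k else 0) (coeff p k)"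
  unfolding has_multidegree_def
proof (intro ballI conjI allI impI)
  fix m
  assume "m \<in> Poly_Mapping.keys (coeff p k)"
  then have m: "Poly_Mapping.keys m \<subseteq> {i} \<times> {..d}" "mdeg m + k = n"
    using assms(1) by (auto simp: bihomogeneous_def)
  then show "Poly_Mapping.keys m \<subseteq> {..<r} \<times> {..d}"
    using assms(2) by blast
  have "mdeg m = (\<Sum>v\<in>{i} \<times> {..d}. Poly_Mapping.lookup m v)"
    by (rule mdeg_superset) (use m(1) in auto)
  also have "\<dots> = (\<Sum>i\<in>{i}. \<Sum>j\<le>d. Poly_Mapping.lookup m (i, j))"
    by (subst sum.Sigma) simp_all
  finally have "mdeg m = (\<Sum>j\<le>d. Poly_Mapping.lookup m (i, j))"
    by simp
  moreover have "Poly_Mapping.lookup m (i', j) = 0" if "i' \<noteq> i" for i' j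
    using m(1) that by (auto simp: in_keys_iff)
  ultimately show "(\<Sum>j\<le>d. Poly_Mapping.lookup m (i', j)) = (if i' = i then n - k else 0)" for i'
    using m(2) by auto
qed

lemma finite_monomials: "finite {m. Poly_Mapping.keys m \<subseteq> {..d::nat} \<and> mdeg m = \<delta>}" (is "finite ?C")
proof (rule finite_imageD)
  have "Poly_Mapping.lookup m v \<le> mdeg m" for m :: "nat \<Rightarrow>\<^sub>0 nat" and v
    unfolding mdeg_def by (cases "v \<in> Poly_Mapping.keys m") (auto simp: in_keys_iff intro: member_le_sum)
  then have "Poly_Mapping.lookup ` ?C \<subseteq> {f. \<forall>v. (v \<in> {..d} \<longrightarrow> f v \<in> {..\<delta>}) \<and> (v \<notin> {..d} \<longrightarrow> f v = 0)}"
    by (auto simp: in_keys_iff subset_iff)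
  then show "finite (Poly_Mapping.lookup ` ?C)"
    using finite_set_of_finite_funs[of "{..d}" "{..\<delta>}" "0 :: nat"] by (rule finite_subset) simp_all
  show "inj_on Poly_Mapping.lookup ?C"
    by (rule inj_onI, rule poly_mapping_eqI) simp
qed

lemma zero_in_max_ideal_power: "0 \<in> max_ideal_power d P n"
proof (cases n)
  case 0
  have "0 = Fract 0 (1 :: (nat, 'a) mpoly)" "homogeneous d 0 (1 :: (nat, 'a) mpoly)"
    by (simp_all add: Zero_fract_def homogeneous_def)
  then show ?thesis
    unfolding 0 max_ideal_power.simps local_ring_def
    by (intro CollectI exI[of _ 0] exI[of _ 1]) auto
next
  case (Suc k)
  show ?thesis
    unfolding Suc max_ideal_power.simps ideal_prod_def
    by (intro CollectI exI[of _ "\<lambda>_. 0"] exI[of _ 0]) simp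
qed

text \<open>
  Semicontinuity, in the form needed: the columns of the linear system are the monomials of degree
  \<open>\<delta>\<close>, and there is one row for every point, every direction and every order below \<open>\<mu>\<close>.
\<close>

lemma for_general_points_fat_point_forms_trivial:
  fixes z :: "nat \<Rightarrow> nat \<Rightarrow> 'k::field"
  assumes z: "\<And>i. i < r \<Longrightarrow> z i \<in> coord_vectors d"
    and trivial: "\<And>F. homogeneous d \<delta> F \<Longrightarrow> (\<And>i. i < r \<Longrightarrow> mult_at_least \<mu> (z i) F) \<Longrightarrow> F = 0"
  shows "for_general_points d r (\<lambda>p :: nat \<Rightarrow> (nat \<Rightarrow> 'k) set. fat_point_forms d \<delta> \<mu> r p = {0})"
proof -
  define C where "C = {m. Poly_Mapping.keys m \<subseteq> {..d} \<and> mdeg m = \<delta>}"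
  have finC: "finite C"
    unfolding C_def by (rule finite_monomials)
  define row :: "nat \<times> (nat \<Rightarrow> 'k) \<times> nat \<Rightarrow> (nat \<Rightarrow>\<^sub>0 nat) \<Rightarrow> (nat \<times> nat, 'k) mpoly"
    where "row = (\<lambda>(i, y, k) m. coeff (monom_at (generic_line i y) m) k)"
  define R where "R = row ` ({..<r} \<times> UNIV \<times> {..<\<mu>})"
  let ?e = "\<lambda>x :: nat \<Rightarrow> nat \<Rightarrow> 'k. eval (\<lambda>(i, j). x i j)"
  have rows: "(\<forall>\<rho>\<in>R. (\<Sum>m\<in>C. ?e x (\<rho> m) * Poly_Mapping.lookup F m) = 0) \<longleftrightarrow>
      (\<forall>i<r. mult_at_least \<mu> (x i) F)" if "homogeneous d \<delta> F" for x F
  proof -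
    have FC: "Poly_Mapping.keys F \<subseteq> C"
      using that by (auto simp: homogeneous_iff C_def)
    have "coeff (on_line (x i) y F) k = (\<Sum>m\<in>C. ?e x (row (i, y, k) m) * Poly_Mapping.lookup F m)" for i y k
      unfolding on_line_def row_def
      by (subst subst_into_superset[OF _ finC FC])
        (simp_all add: coeff_sum eval_coeff_generic_line mult.commute)
    then show ?thesis
      by (auto simp: R_def mult_at_least_def monom_1_dvd_iff')
  qed
  have "\<exists>D e. has_multidegree d r e D \<and> ?e z D \<noteq> 0 \<and>
           (\<forall>x u. eval x D \<noteq> 0 \<longrightarrow> (\<forall>\<rho>\<in>R. (\<Sum>m\<in>C. eval x (\<rho> m) * u m) = 0) \<longrightarrow> (\<forall>m\<in>C. u m = 0))"
  proof (rule kernel_trivial_generically[OF finC])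
    fix \<rho>
    assume "\<rho> \<in> R"
    then obtain i y k where \<rho>: "i < r" "\<rho> = row (i, y, k)"
      by (auto simp: R_def)
    have "has_multidegree d r (\<lambda>i'. if i' = i then \<delta> - k else 0) (\<rho> m)" if "m \<in> C" for m
      using bihomogeneous_monom_at_generic_line[of m d i y] that \<rho>
      by (auto simp: row_def C_def intro: has_multidegree_coeff)
    then show "\<exists>e. \<forall>m\<in>C. has_multidegree d r e (\<rho> m)"
      by blast
  next
    fix u
    assume u: "\<forall>\<rho>\<in>R. (\<Sum>m\<in>C. ?e z (\<rho> m) * u m) = 0"
    define F where "F = (\<Sum>m\<in>C. Poly_Mapping.single m (u m))"
    have F: "Poly_Mapping.lookup F m = (if m \<in> C then u m else 0)" for m
      using finC by (simp add: F_def lookup_sum lookup_single when_def)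
    have hom: "homogeneous d \<delta> F"
      unfolding F_def by (intro homogeneous_sum homogeneous_single) (auto simp: C_def)
    have "\<forall>\<rho>\<in>R. (\<Sum>m\<in>C. ?e z (\<rho> m) * Poly_Mapping.lookup F m) = 0"
      using u by (simp add: F)
    then have "F = 0"
      using trivial[OF hom] rows[OF hom] by blast
    then show "\<forall>m\<in>C. u m = 0"
      using F by (metis lookup_zero)
  qed
  then obtain D e where D: "has_multidegree d r e D" "?e z D \<noteq> 0"
    "\<And>x u. ?e x D \<noteq> 0 \<Longrightarrow> \<forall>\<rho>\<in>R. (\<Sum>m\<in>C. ?e x (\<rho> m) * u m) = 0 \<Longrightarrow> \<forall>m\<in>C. u m = 0"
    by blast
  define U where "U = {p \<in> proj_tuples d r. \<exists>x. (\<forall>i<r. x i \<in> p i) \<and> ?e x D \<noteq> 0}"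
  have "zariski_closed d r (proj_tuples d r - U)"
    unfolding zariski_closed_def
    by (rule exI[of _ "{D}"]) (use D(1) in \<open>auto simp: U_def multihomogeneous_iff\<close>)
  then have "zariski_open d r U"
    by (auto simp: zariski_open_def U_def)
  moreover have "(\<lambda>i\<in>{..<r}. proj_rel d `` {z i}) \<in> U"
  proof -
    have "z i \<in> proj_rel d `` {z i}" if "i < r" for i
      using equiv_class_self[OF equiv_proj_rel] z[OF that] .
    then show ?thesis
      using D(2) z by (auto simp: U_def proj_tuples_def proj_space_def intro!: quotientI exI[of _ z])
  qed
  moreover have "fat_point_forms d \<delta> \<mu> r p = {0}" if "p \<in> U" for p
  proof -
    obtain x where x: "\<And>i. i < r \<Longrightarrow> x i \<in> p i" "?e x D \<noteq> 0" and p: "p \<in> proj_tuples d r"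
      using \<open>p \<in> U\<close> by (auto simp: U_def)
    have "F = 0" if F: "F \<in> fat_point_forms d \<delta> \<mu> r p" for F
    proof -
      have hom: "homogeneous d \<delta> F"
        using F by (simp add: fat_point_forms_def)
      have "\<forall>i<r. mult_at_least \<mu> (x i) F"
        using F p x(1) by (auto simp: fat_point_forms_def proj_tuples_def
            intro: vanishes_to_order_imp_mult_at_least[of "p _" d])
      then have "\<forall>m\<in>C. Poly_Mapping.lookup F m = 0"
        using D(3)[OF x(2)] rows[OF hom] by blast
      moreover have "Poly_Mapping.keys F \<subseteq> C"
        using hom by (auto simp: homogeneous_iff C_def)
      ultimately show "F = 0"
        by (intro poly_mapping_eqI) (auto simp: in_keys_iff)
    qed
    moreover have "0 \<in> fat_point_forms d \<delta> \<mu> r p"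
      by (simp add: fat_point_forms_def vanishes_to_order_def zero_in_max_ideal_power
          eq_fract(3)[of _ 1, folded Zero_fract_def])
    ultimately show ?thesis
      by blast
  qed
  ultimately show ?thesis
    unfolding for_general_points_def by blast
qed


section \<open>General points\<close>

text \<open>
  Over a finite field, adding \<open>1\<close> to the product of all \<open>X - a\<close> gives a polynomial without roots.
\<close>

lemma infinite_UNIV_alg_closed: "infinite (UNIV :: 'k::alg_closed_field set)"
proof
  assume fin: "finite (UNIV :: 'k set)"
  define p where "p = (\<Prod>a\<in>(UNIV :: 'k set). [:- a, 1:])"
  have "degree p = card (UNIV :: 'k set)"
    unfolding p_def by (subst degree_prod_eq_sum_degree) auto
  then have "degree (p + 1) > 0"
    using fin by (simp add: degree_add_eq_left card_gt_0_iff)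
  then obtain x where "poly (p + 1) x = 0"
    using alg_closed_imp_poly_has_root by blast
  moreover have "poly p x = 0"
    using fin by (auto simp: p_def poly_prod)
  ultimately show False
    by simp
qed

theorem theorem6:
  fixes d s r \<delta> \<mu> :: nat
  assumes "d \<ge> 2" and "s \<ge> 1" and "r = s ^ d" and "\<mu> \<ge> 1"
    and "real \<delta> < root d (real r) * real \<mu>"
  shows "general_dim TYPE('k::alg_closed_field) d \<delta> \<mu> r = 0 \<and>
         for_general_points d r
           (\<lambda>p :: nat \<Rightarrow> (nat \<Rightarrow> 'k) set. fat_point_forms d \<delta> \<mu> r p = {0})"
proof -
  note inf = infinite_UNIV_alg_closed[where 'k = 'k]
  have "root d (real r) = real s"
    using assms(1) by (simp add: assms(3) real_root_power_cancel)
  then have "real \<delta> < real (s * \<mu>)"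
    using assms(5) by simp
  then have lt: "\<delta> < s * \<mu>"
    by (simp only: of_nat_less_iff)
  obtain S :: "'k set" where S: "finite S" "card S = s"
    using infinite_arbitrarily_large[OF inf] by blast
  \<comment> \<open>The affine coordinates of the grid points; their number \<open>s ^ d\<close> is the number of points.\<close>
  define A where "A = {1..d} \<rightarrow>\<^sub>E S"
  have "finite A" "card A = r"
    using S by (simp_all add: A_def finite_PiE card_PiE assms(3))
  then obtain a where a: "bij_betw a {..<r} A"
    using ex_bij_betw_nat_finite by (metis atLeast0LessThan)
  define z where "z i j = (if j = 0 then 1 else if j \<le> d then a i j else 0)" for i j :: nat
  have gen: "for_general_points d r (\<lambda>p :: nat \<Rightarrow> (nat \<Rightarrow> 'k) set. fat_point_forms d \<delta> \<mu> r p = {0})"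
  proof (rule for_general_points_fat_point_forms_trivial)
    show "z i \<in> coord_vectors d" for i
      by (auto simp: coord_vectors_def z_def intro!: exI[of _ 0])
  next
    fix F :: "(nat, 'k) mpoly"
    assume F: "homogeneous d \<delta> F" "\<And>i. i < r \<Longrightarrow> mult_at_least \<mu> (z i) F"
    show "F = 0"
    proof (rule form_zero_if_mult_on_grid[OF inf S(1) F(1), where \<mu> = \<mu>])
      fix x :: "nat \<Rightarrow> 'k"
      assume x: "x 0 = 1" "\<forall>j\<in>{1..d}. x j \<in> S"
      then have "restrict x {1..d} \<in> A"
        by (auto simp: A_def)
      then obtain i where i: "i < r" "a i = restrict x {1..d}"
        using a unfolding bij_betw_def by (metis imageE lessThan_iff)
      then have "z i j = x j" if "j \<le> d" for j
        using that x(1) by (simp add: z_def)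
      then have "on_line (z i) y F = on_line x y F" for y
        by (intro on_line_cong[OF F(1)]) simp_all
      then show "mult_at_least \<mu> x F"
        using F(2)[OF i(1)] by (simp add: mult_at_least_def)
    qed (simp add: S(2) lt)
  qed
  interpret vector_space "scale :: 'k \<Rightarrow> (nat, 'k) mpoly \<Rightarrow> (nat, 'k) mpoly"
    by (rule vector_space_scale)
  have "dim {0} = 0"
    by (rule dim_unique[of "{}"]) (simp_all add: independent_empty)
  then have "general_dim TYPE('k) d \<delta> \<mu> r = 0"
    using gen by (intro general_dim_eqI) (auto simp: for_general_points_def)
  then show ?thesis
    using gen by blast
qed

end
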